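(* Let $r,s\ge 1$ and $t\ge 2$ be integers, and let $P^t_{r,s}$ denote the number of $t$-cores $\lambda$ whose Young diagram fits inside the $r\times s$ rectangle (i.e. $\ell(\lambda)\le r$ and $\lambda_1\le s$). For $0\le i\le t-1$ let $n_i=\left\lfloor \frac{r+s+t-1-i}{t}\right\rfloor$. Then $$P^t_{r,s}=[q^r]\prod_{i=0}^{t-1}\left(1+q+\cdots+q^{n_i}\right).$$
   Context: A partition $\lambda=(\lambda_1\ge\lambda_2\ge\cdots)$ is a weakly decreasing finite sequence of positive integers (possibly empty); $\ell(\lambda)$ is its number of parts, and $\lambda_1=0$ if $\lambda$ is empty. A rim-hook of $\lambda$ is a connected skew shape $\lambda/\mu$ (with $\mu\subseteq\lambda$ a partition) containing no $2\times 2$ block of boxes; a $t$-rim hook is a rim-hook with exactly $t$ boxes. A partition is a $t$-core if no $t$-rim hook can be removed from it so as to leave the Young diagram of a partition. For a polynomial $p(q)$, $[q^n]p(q)$ denotes the coefficient of $q^n$. *)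

theory Defs
  imports "HOL-Computational_Algebra.Polynomial"
begin

definition is_partition :: "nat list \<Rightarrow> bool" where
  "is_partition \<nu> \<longleftrightarrow> sorted_wrt (\<ge>) \<nu> \<and> (\<forall>x\<in>set \<nu>. 0 < x)"

definition first_part :: "nat list \<Rightarrow> nat" where
  "first_part \<nu> = (case \<nu> of [] \<Rightarrow> 0 | x # _ \<Rightarrow> x)"

text \<open>Boxes are pairs (row, column), both counted from 0.\<close>

definition young_diagram :: "nat list \<Rightarrow> (nat \<times> nat) set" where
  "young_diagram \<nu> = {(i, j). i < length \<nu> \<and> j < \<nu> ! i}"

text \<open>Two boxes are adjacent if they share an edge; sharing only a corner does not count.\<close>

definition adjacent :: "nat \<times> nat \<Rightarrow> nat \<times> nat \<Rightarrow> bool" where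
  "adjacent a b \<longleftrightarrow>
     (fst a = fst b \<and> (snd b = Suc (snd a) \<or> snd a = Suc (snd b))) \<or>
     (snd a = snd b \<and> (fst b = Suc (fst a) \<or> fst a = Suc (fst b)))"

definition connected_shape :: "(nat \<times> nat) set \<Rightarrow> bool" where
  "connected_shape D \<longleftrightarrow>
     (\<forall>a\<in>D. \<forall>b\<in>D. (a, b) \<in> {(x, y). x \<in> D \<and> y \<in> D \<and> adjacent x y}\<^sup>*)"

definition contains_2x2_block :: "(nat \<times> nat) set \<Rightarrow> bool" where
  "contains_2x2_block D \<longleftrightarrow>
     (\<exists>i j. {(i, j), (i, Suc j), (Suc i, j), (Suc i, Suc j)} \<subseteq> D)"

definition skew_shape :: "nat list \<Rightarrow> nat list \<Rightarrow> (nat \<times> nat) set" where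
  "skew_shape \<nu> \<mu> = young_diagram \<nu> - young_diagram \<mu>"

text \<open>The rim-hook is given by the partition \<open>\<mu>\<close> that remains after its removal from \<open>\<nu>\<close>.\<close>

definition is_rim_hook :: "nat list \<Rightarrow> nat list \<Rightarrow> bool" where
  "is_rim_hook \<nu> \<mu> \<longleftrightarrow>
     is_partition \<mu> \<and> young_diagram \<mu> \<subseteq> young_diagram \<nu> \<and>
     connected_shape (skew_shape \<nu> \<mu>) \<and> \<not> contains_2x2_block (skew_shape \<nu> \<mu>)"

definition is_t_rim_hook :: "nat \<Rightarrow> nat list \<Rightarrow> nat list \<Rightarrow> bool" where
  "is_t_rim_hook t \<nu> \<mu> \<longleftrightarrow> is_rim_hook \<nu> \<mu> \<and> card (skew_shape \<nu> \<mu>) = t"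

definition is_t_core :: "nat \<Rightarrow> nat list \<Rightarrow> bool" where
  "is_t_core t \<nu> \<longleftrightarrow> is_partition \<nu> \<and> \<not> (\<exists>\<mu>. is_t_rim_hook t \<nu> \<mu>)"

definition t_cores_in_rectangle :: "nat \<Rightarrow> nat \<Rightarrow> nat \<Rightarrow> nat list set" where
  "t_cores_in_rectangle t r s = {\<nu>. is_t_core t \<nu> \<and> length \<nu> \<le> r \<and> first_part \<nu> \<le> s}"

lemma finite_t_cores_in_rectangle: "finite (t_cores_in_rectangle t r s)"
proof (rule finite_subset)
  show "t_cores_in_rectangle t r s \<subseteq> {\<nu>. set \<nu> \<subseteq> {..s} \<and> length \<nu> \<le> r}"
    by (fastforce simp: t_cores_in_rectangle_def is_t_core_def is_partition_def
        first_part_def split: list.splits)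
  show "finite {\<nu>. set \<nu> \<subseteq> {..s} \<and> length \<nu> \<le> r}"
    by (rule finite_lists_length_le) simp
qed

definition num_t_cores :: "nat \<Rightarrow> nat \<Rightarrow> nat \<Rightarrow> nat" where
  "num_t_cores t r s = card (t_cores_in_rectangle t r s)"

end

theory Submission
  imports Defs "HOL-Library.FuncSet"
begin

text \<open>
  Encode a partition inside the rectangle by its beta-set
  \<open>{\<nu>\<^sub>i + (r - 1 - i) | i < r}\<close>, an arbitrary \<open>r\<close>-subset of \<open>{0, \<dots>, r + s - 1}\<close>.
  Removing a \<open>t\<close>-rim hook amounts to replacing some \<open>b\<close> in it by a missing \<open>b - t\<close>,
  so \<open>t\<close>-cores correspond to the sets closed under subtracting \<open>t\<close>. On every residue class
  modulo \<open>t\<close> such a set is an initial segment, so it is given by its numbers of elements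
  in the classes: these sum to \<open>r\<close>, and the \<open>i\<close>-th is bounded by the size \<open>n\<^sub>i\<close> of its class.
\<close>

section \<open>Partitions as antitone functions\<close>

text \<open>Padding the rows with zeros turns containment and skew shapes into pointwise
  inequalities, without case distinctions on list lengths.\<close>

definition part :: "nat list \<Rightarrow> nat \<Rightarrow> nat" where
  "part \<nu> i = (if i < length \<nu> then \<nu> ! i else 0)"

lemma young_diagram_part: "young_diagram \<nu> = {(i, j). j < part \<nu> i}"
  by (auto simp: young_diagram_def part_def split: if_splits)

lemma skew_shape_part: "skew_shape \<nu> \<mu> = {(i, j). part \<mu> i \<le> j \<and> j < part \<nu> i}"
  by (auto simp: skew_shape_def young_diagram_part)

lemma young_diagram_subset_iff:
  "young_diagram \<mu> \<subseteq> young_diagram \<nu> \<longleftrightarrow> (\<forall>i. part \<mu> i \<le> part \<nu> i)"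
proof
  assume sub: "young_diagram \<mu> \<subseteq> young_diagram \<nu>"
  show "\<forall>i. part \<mu> i \<le> part \<nu> i"
  proof (intro allI leI notI)
    fix i assume "part \<nu> i < part \<mu> i"
    hence "(i, part \<nu> i) \<in> young_diagram \<mu>" by (simp add: young_diagram_part)
    with sub show False by (auto simp: young_diagram_part)
  qed
next
  assume "\<forall>i. part \<mu> i \<le> part \<nu> i"
  thus "young_diagram \<mu> \<subseteq> young_diagram \<nu>"
    by (auto simp: young_diagram_part intro: less_le_trans)
qed

lemma first_part_part: "first_part \<nu> = part \<nu> 0"
  by (auto simp: first_part_def part_def split: list.splits)

lemma antimono_part:
  assumes "is_partition \<nu>"
  shows "antimono (part \<nu>)"
proof (rule antimonoI)
  fix i j :: nat assume "i \<le> j"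
  with assms show "part \<nu> j \<le> part \<nu> i"
    by (cases "i = j") (auto simp: part_def is_partition_def sorted_wrt_iff_nth_less)
qed

lemma part_pos_iff:
  assumes "is_partition \<nu>"
  shows "0 < part \<nu> i \<longleftrightarrow> i < length \<nu>"
  using assms by (auto simp: part_def is_partition_def)

lemma part_inject:
  assumes "is_partition \<nu>" "is_partition \<mu>" "part \<nu> = part \<mu>"
  shows "\<nu> = \<mu>"
proof (rule nth_equalityI)
  show len: "length \<nu> = length \<mu>"
    using part_pos_iff[OF assms(1)] part_pos_iff[OF assms(2)] assms(3)
    by (metis less_irrefl_nat linorder_neqE_nat)
  fix i assume "i < length \<nu>"
  thus "\<nu> ! i = \<mu> ! i" using assms(3) len by (metis part_def)
qed

text \<open>Cutting \<open>l\<close> at its first zero gives the list of positive parts;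
  antitonicity keeps every later value zero. Together with \<open>part_inject\<close> this lets
  partitions be replaced by antitone functions.\<close>

lemma ex_partition_part:
  assumes "antimono l" "l r = 0"
  obtains \<nu> where "is_partition \<nu>" "part \<nu> = l" "length \<nu> \<le> r"
proof
  define n where "n = (LEAST n. l n = 0)"
  have ln: "l n = 0" unfolding n_def using assms(2) by (rule LeastI)
  have pos: "0 < l k" if "k < n" for k
    using not_less_Least[of k "\<lambda>n. l n = 0"] that n_def by auto
  have zero: "l k = 0" if "n \<le> k" for k
    using antimonoD[OF assms(1) that] ln by simp
  show "is_partition (map l [0..<n])"
    using pos assms(1) by (auto simp: is_partition_def sorted_wrt_iff_nth_less antimono_def)
  show "part (map l [0..<n]) = l"
    using zero by (auto simp: part_def)
  show "length (map l [0..<n]) \<le> r"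
    using assms(2) by (simp add: n_def Least_le)
qed

section \<open>Ribbons\<close>

text \<open>The shape between \<open>m\<close> and \<open>l\<close> is a rim hook in rows
  \<open>i\<close> to \<open>j\<close>. The middle equation says that rows \<open>k\<close> and
  \<open>Suc k\<close> share exactly the column \<open>m k\<close>, which is the first of row
  \<open>k\<close> and the last of row \<open>Suc k\<close>.\<close>

definition ribbon :: "(nat \<Rightarrow> nat) \<Rightarrow> (nat \<Rightarrow> nat) \<Rightarrow> nat \<Rightarrow> nat \<Rightarrow> bool" where
  "ribbon l m i j \<longleftrightarrow> i \<le> j \<and> (\<forall>k. k < i \<or> j < k \<longrightarrow> m k = l k) \<and>
     (\<forall>k. i \<le> k \<and> k < j \<longrightarrow> Suc (m k) = l (Suc k)) \<and> m j < l j"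

lemma ribbon_row_nonempty:
  assumes "antimono l" "ribbon l m i j" "i \<le> k" "k \<le> j"
  shows "m k < l k"
proof (cases "k = j")
  case True
  thus ?thesis using assms(2) by (simp add: ribbon_def)
next
  case False
  hence "Suc (m k) = l (Suc k)" using assms by (simp add: ribbon_def)
  moreover have "l (Suc k) \<le> l k" using assms(1) by (simp add: antimono_def)
  ultimately show ?thesis by simp
qed

lemma ribbon_le:
  assumes "antimono l" "ribbon l m i j"
  shows "m k \<le> l k"
proof (cases "i \<le> k \<and> k \<le> j")
  case True
  thus ?thesis using ribbon_row_nonempty[OF assms] by (simp add: less_imp_le)
next
  case False
  thus ?thesis using assms(2) by (auto simp: ribbon_def not_le)
qed

lemma ribbon_rows:
  assumes "ribbon l m i j" "m k \<le> c" "c < l k"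
  shows "i \<le> k" "k \<le> j"
  using assms by (fastforce simp: ribbon_def not_le[symmetric])+

text \<open>From any box one can walk left to the start of its row, step down to the end of the next
  row, and repeat until \<open>(j, m j)\<close>. Adjacency is symmetric, so any two boxes are joined
  through this one.\<close>

lemma ribbon_connected:
  assumes l: "antimono l" and rib: "ribbon l m i j"
  shows "connected_shape {(k, c). m k \<le> c \<and> c < l k}" (is "connected_shape ?D")
proof -
  define E where "E = {(x, y). x \<in> ?D \<and> y \<in> ?D \<and> adjacent x y}"
  have "sym E" by (auto simp: E_def sym_def adjacent_def)
  hence sym: "sym (E\<^sup>*)" by (rule sym_rtrancl)
  have row: "((k, m k + d), (k, m k)) \<in> E\<^sup>*" if "m k + d < l k" for k d
    using that
  proof (induction d)
    case (Suc d)
    hence "((k, m k + Suc d), (k, m k + d)) \<in> E"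
      by (auto simp: E_def adjacent_def)
    thus ?case using Suc by (meson Suc_lessD add_Suc_right converse_rtrancl_into_rtrancl
        less_trans lessI add_less_cancel_left)
  qed simp
  have last: "((k, m k), (j, m j)) \<in> E\<^sup>*" if "i \<le> k" "k \<le> j" for k
    using that(2,1)
  proof (induction rule: inc_induct)
    case (step k)
    have eq: "Suc (m k) = l (Suc k)" using rib step by (simp add: ribbon_def)
    have lt: "m (Suc k) < l (Suc k)" "m k < l k"
      using ribbon_row_nonempty[OF l rib] step by auto
    have "((k, m k), (Suc k, m k)) \<in> E"
      using eq lt by (auto simp: E_def adjacent_def)
    moreover have "((Suc k, m k), (Suc k, m (Suc k))) \<in> E\<^sup>*"
      using row[of "Suc k" "m k - m (Suc k)"] eq lt by simp
    moreover have "((Suc k, m (Suc k)), (j, m j)) \<in> E\<^sup>*"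
      using step by simp
    ultimately show ?case by (meson converse_rtrancl_into_rtrancl rtrancl_trans)
  qed simp
  have all: "(a, (j, m j)) \<in> E\<^sup>*" if "a \<in> ?D" for a
  proof -
    obtain k c where a: "a = (k, c)" "m k \<le> c" "c < l k" using \<open>a \<in> ?D\<close> by auto
    have "(a, (k, m k)) \<in> E\<^sup>*" using row[of k "c - m k"] a by simp
    with last[OF ribbon_rows[OF rib a(2,3)]] show ?thesis by (rule rtrancl_trans[rotated])
  qed
  show ?thesis unfolding connected_shape_def E_def[symmetric]
    using all sym by (meson rtrancl_trans symD)
qed

text \<open>A block would need two columns common to consecutive rows, but these share only the
  column \<open>m k\<close>.\<close>

lemma ribbon_no_block:
  assumes l: "antimono l" and rib: "ribbon l m i j"
  shows "\<not> contains_2x2_block {(k, c). m k \<le> c \<and> c < l k}"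
proof
  assume "contains_2x2_block {(k, c). m k \<le> c \<and> c < l k}"
  then obtain k c where "m k \<le> c" "c < l k" "m (Suc k) \<le> c" "Suc c < l (Suc k)"
    by (auto simp: contains_2x2_block_def)
  moreover from this have "i \<le> k" "Suc k \<le> j"
    using ribbon_rows(1)[OF rib, of k c] ribbon_rows(2)[OF rib, of "Suc k" c] by auto
  hence "Suc (m k) = l (Suc k)" using rib by (simp add: ribbon_def)
  ultimately show False by simp
qed

text \<open>The row sizes \<open>l k - m k\<close> telescope, because \<open>m k\<close> is one less
  than \<open>l (Suc k)\<close>: each passage to the next row contributes one extra box. The
  additive form avoids truncated subtraction.\<close>

lemma ribbon_card:
  assumes l: "antimono l" and rib: "ribbon l m i j"
  shows "card {(k, c). m k \<le> c \<and> c < l k} + m j = l i + (j - i)"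
proof -
  have "{(k, c). m k \<le> c \<and> c < l k} = (SIGMA k:{i..j}. {m k..<l k})"
    using ribbon_rows[OF rib] by auto
  hence card: "card {(k, c). m k \<le> c \<and> c < l k} = (\<Sum>k=i..j. l k - m k)"
    by simp
  have "i \<le> j" using rib by (simp add: ribbon_def)
  have "(\<Sum>k=i..n. l k - m k) + m n = l i + (n - i)" if "i \<le> n" "n \<le> j" for n
    using that
  proof (induction n rule: dec_induct)
    case base
    show ?case using ribbon_le[OF l rib, of i] by simp
  next
    case (step n)
    have "Suc (m n) = l (Suc n)" using rib step by (simp add: ribbon_def)
    thus ?case using step ribbon_le[OF l rib, of "Suc n"] by simp
  qed
  with card \<open>i \<le> j\<close> show ?thesis by simp
qed

section \<open>Connected shapes without blocks are ribbons\<close>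

text \<open>One step changes the row by at most one, so a path from row at most \<open>k\<close> to
  a row beyond \<open>k\<close> contains a vertical step from row \<open>k\<close> to row
  \<open>Suc k\<close>.\<close>

lemma connected_shape_crossing:
  assumes "connected_shape D" "a \<in> D" "b \<in> D" "fst a \<le> k" "k < fst b"
  obtains c where "(k, c) \<in> D" "(Suc k, c) \<in> D"
proof -
  have "(a, b) \<in> {(x, y). x \<in> D \<and> y \<in> D \<and> adjacent x y}\<^sup>*"
    using assms by (simp add: connected_shape_def)
  hence "\<exists>c. (k, c) \<in> D \<and> (Suc k, c) \<in> D" using assms(4,5)
  proof (induction rule: converse_rtrancl_induct)
    case (step x y)
    show ?case
    proof (cases "fst y \<le> k")
      case True
      thus ?thesis using step by blast
    next
      case False
      with step have "fst x = k" "fst y = Suc k" "snd x = snd y"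
        by (auto simp: adjacent_def)
      thus ?thesis using step(1) by (cases x; cases y) auto
    qed
  qed simp
  thus thesis using that by blast
qed

text \<open>Take the first and the last nonempty row. Connectedness forces consecutive rows in
  between to share at least one column, and the absence of a block forces at most one.\<close>

lemma ex_ribbon:
  assumes l: "antimono l" and m: "antimono m" and le: "\<And>k. m k \<le> l k"
    and D: "D = {(k, c). m k \<le> c \<and> c < l k}"
    and conn: "connected_shape D" and nb: "\<not> contains_2x2_block D"
    and fin: "finite D" and ne: "D \<noteq> {}"
  obtains i j where "ribbon l m i j"
proof
  define i where "i = Min (fst ` D)"
  define j where "j = Max (fst ` D)"
  have bounds: "i \<le> fst a" "fst a \<le> j" if "a \<in> D" for a
    using that fin by (auto simp: i_def j_def)
  have "i \<in> fst ` D" "j \<in> fst ` D"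
    unfolding i_def j_def using fin ne by (auto intro!: Min_in Max_in)
  then obtain a b where ab: "a \<in> D" "b \<in> D" "fst a = i" "fst b = j" by auto
  have "i \<le> j" using bounds(2)[OF ab(1)] ab by simp
  moreover have "m k = l k" if "k < i \<or> j < k" for k
  proof (rule ccontr)
    assume "m k \<noteq> l k"
    hence "(k, m k) \<in> D" using le[of k] by (simp add: D)
    thus False using bounds that by fastforce
  qed
  moreover have "Suc (m k) = l (Suc k)" if k: "i \<le> k" "k < j" for k
  proof (rule antisym)
    obtain c where "(k, c) \<in> D" "(Suc k, c) \<in> D"
      using connected_shape_crossing[OF conn ab(1,2), of k] ab(3,4) k by metis
    thus "Suc (m k) \<le> l (Suc k)" by (auto simp: D)
    show "l (Suc k) \<le> Suc (m k)"
    proof (rule leI, rule notI)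
      assume "Suc (m k) < l (Suc k)"
      moreover have "l (Suc k) \<le> l k" "m (Suc k) \<le> m k"
        using l m by (simp_all add: antimono_def)
      ultimately have "contains_2x2_block D"
        unfolding contains_2x2_block_def by (intro exI[of _ k] exI[of _ "m k"]) (auto simp: D)
      with nb show False ..
    qed
  qed
  moreover have "m j < l j" using ab by (auto simp: D)
  ultimately show "ribbon l m i j" by (auto simp: ribbon_def)
qed

section \<open>Beta-sets\<close>

text \<open>For a partition with exactly \<open>r\<close> parts these are the hook lengths of the
  first column; shorter partitions are padded with empty rows. Only rows \<open>i < r\<close>
  matter.\<close>

definition beta_fun :: "nat \<Rightarrow> (nat \<Rightarrow> nat) \<Rightarrow> nat \<Rightarrow> nat" where
  "beta_fun r l i = l i + (r - Suc i)"

definition beta :: "nat \<Rightarrow> (nat \<Rightarrow> nat) \<Rightarrow> nat set" where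
  "beta r l = beta_fun r l ` {..<r}"

lemma beta_fun_less:
  assumes "antimono l" "i < j" "j < r"
  shows "beta_fun r l j < beta_fun r l i"
proof -
  have "l j \<le> l i" using assms by (simp add: antimono_def)
  thus ?thesis using assms by (simp add: beta_fun_def)
qed

lemma beta_fun_less_iff:
  assumes "antimono l" "i < r" "j < r"
  shows "beta_fun r l j < beta_fun r l i \<longleftrightarrow> i < j"
  using beta_fun_less[OF assms(1)] assms(2,3) by (metis less_asym linorder_neqE_nat less_irrefl_nat)

lemma inj_on_beta_fun: "antimono l \<Longrightarrow> inj_on (beta_fun r l) {..<r}"
  by (rule inj_onI) (metis beta_fun_less_iff lessThan_iff less_irrefl_nat linorder_neqE_nat)

section \<open>Rim hooks as moves in the beta-set\<close>

text \<open>Removing the ribbon lowers the beta-number of its top row \<open>i\<close> by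
  \<open>t\<close>, giving the beta-number of row \<open>j\<close> of \<open>m\<close>. This value
  lies strictly between the beta-numbers of \<open>l\<close> in rows up to \<open>j\<close> and
  those in later rows, so it is missing.\<close>

lemma ribbon_imp_missing:
  assumes l: "antimono l" and m: "antimono m" and lr: "l r = 0" and rib: "ribbon l m i j"
    and t: "card {(k, c). m k \<le> c \<and> c < l k} = t"
  shows "\<exists>b\<in>beta r l. t \<le> b \<and> b - t \<notin> beta r l"
proof -
  have ij: "i \<le> j" and mj: "m j < l j" using rib by (auto simp: ribbon_def)
  have jr: "j < r"
  proof (rule ccontr)
    assume "\<not> j < r"
    hence "l j \<le> l r" using l by (simp add: antimono_def)
    with lr mj show False by simp
  qed
  have tot: "t + m j = l i + (j - i)" using ribbon_card[OF l rib] t by simp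
  define v where "v = m j + (r - Suc j)"
  have v: "beta_fun r l i = v + t" using tot ij jr by (simp add: beta_fun_def v_def)
  have "v \<notin> beta r l"
  proof
    assume "v \<in> beta r l"
    then obtain k where k: "k < r" "v = beta_fun r l k" by (auto simp: beta_def)
    show False
    proof (cases "k \<le> j")
      case True
      hence "l j \<le> l k" using l by (simp add: antimono_def)
      thus False using k True jr mj by (simp add: v_def beta_fun_def)
    next
      case False
      hence "l k = m k" using rib by (simp add: ribbon_def)
      moreover have "m k \<le> m j" using m False by (simp add: antimono_def)
      ultimately show False using k False jr by (simp add: v_def beta_fun_def)
    qed
  qed
  moreover have "beta_fun r l i \<in> beta r l" using ij jr by (simp add: beta_def)
  ultimately show ?thesis using v by (intro bexI[of _ "beta_fun r l i"]) auto
qed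

text \<open>Replace \<open>b\<close> by \<open>b - t\<close> and sort again. The new number drops
  from row \<open>i\<close> to row \<open>j\<close>, and the numbers of the rows in between each
  move up one row; reading off row lengths gives a ribbon.\<close>

lemma missing_imp_ribbon:
  assumes l: "antimono l" and lr: "l r = 0" and b: "b \<in> beta r l"
    and t: "0 < t" "t \<le> b" "b - t \<notin> beta r l"
  obtains m i j where "antimono m" "m r = 0" "ribbon l m i j"
    "card {(k, c). m k \<le> c \<and> c < l k} = t"
proof -
  define v where "v = b - t"
  have bv: "b = v + t" using t by (simp add: v_def)
  obtain i where i: "i < r" "b = beta_fun r l i" using b by (auto simp: beta_def)
  define S where "S = {k. k < r \<and> v < beta_fun r l k}"
  \<comment> \<open>The last row whose beta-number exceeds \<open>v\<close> is where
    \<open>v\<close> belongs after sorting.\<close>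
  define j where "j = Max S"
  have finS: "finite S" by (simp add: S_def)
  have iS: "i \<in> S" using i bv t by (simp add: S_def)
  have "j \<in> S" unfolding j_def using finS iS by (intro Max_in) auto
  hence jr: "j < r" and vj: "v < beta_fun r l j" by (auto simp: S_def)
  have ij: "i \<le> j" unfolding j_def using finS iS by simp
  have after: "beta_fun r l k < v" if "j < k" "k < r" for k
  proof -
    have "k \<notin> S" using that(1) Max_ge[OF finS, of k] by (auto simp: j_def)
    moreover have "beta_fun r l k \<in> beta r l" using that by (simp add: beta_def)
    hence "beta_fun r l k \<noteq> v" using t(3) by (auto simp: v_def)
    ultimately show ?thesis using that by (simp add: S_def)
  qed
  \<comment> \<open>This bound keeps the subtraction in \<open>m j\<close> from truncating and gives
    \<open>l (Suc j) \<le> m j\<close>. If row \<open>j\<close> is the last of the \<open>r\<close>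
    rows, \<open>l r = 0\<close> replaces the comparison with the next beta-number.\<close>
  have vge: "r - Suc j + l (Suc j) \<le> v"
  proof (cases "Suc j < r")
    case True
    thus ?thesis using after[of "Suc j"] by (simp add: beta_fun_def)
  next
    case False
    hence "Suc j = r" using jr by simp
    thus ?thesis using lr by simp
  qed
  \<comment> \<open>A beta-number that moves up one row keeps its value while the staircase term
    grows by one, hence \<open>l (Suc k) - 1\<close>.\<close>
  define m where "m k = (if i \<le> k \<and> k < j then l (Suc k) - 1
      else if k = j then v - (r - Suc j) else l k)" for k
  have mj: "m j < l j" using vj vge by (auto simp: m_def beta_fun_def)
  have rib: "ribbon l m i j"
    unfolding ribbon_def
  proof (intro conjI allI impI)
    fix k assume k: "i \<le> k \<and> k < j"
    hence "l j \<le> l (Suc k)" using l by (simp add: antimono_def)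
    thus "Suc (m k) = l (Suc k)" using k mj by (simp add: m_def)
  qed (use ij mj in \<open>auto simp: m_def\<close>)
  have anti: "antimono m"
    unfolding antimono_iff_le_Suc
  proof
    fix k
    have dec: "l (Suc k) \<le> l k" "l (Suc (Suc k)) \<le> l (Suc k)"
      using l by (simp_all add: antimono_def)
    consider "Suc k < i" | "Suc k = i" | "i \<le> k" "k < j" | "k = j" | "j < k" by linarith
    thus "m (Suc k) \<le> m k"
    proof cases
      case 3
      have "Suc (m k) = l (Suc k)" using rib 3 by (simp add: ribbon_def)
      moreover have "m (Suc k) < l (Suc k)" using ribbon_row_nonempty[OF l rib] 3 by simp
      ultimately show ?thesis by simp
    next
      case 4
      thus ?thesis using vge by (auto simp: m_def)
    next
      case 2
      hence "m k = l k" using rib by (simp add: ribbon_def)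
      thus ?thesis using ribbon_le[OF l rib, of "Suc k"] dec by simp
    qed (use ij dec in \<open>auto simp: m_def\<close>)
  qed
  have "card {(k, c). m k \<le> c \<and> c < l k} + m j = l i + (j - i)"
    by (rule ribbon_card[OF l rib])
  moreover have "m j + (r - Suc j) = v" using vge by (simp add: m_def)
  moreover have "l i + (r - Suc i) = v + t" using i bv by (simp add: beta_fun_def)
  ultimately have "card {(k, c). m k \<le> c \<and> c < l k} = t" using ij jr by linarith
  moreover have "m r = 0" using jr lr ij by (simp add: m_def)
  ultimately show thesis using that anti rib by blast
qed

lemma is_t_core_iff_beta:
  assumes \<nu>: "is_partition \<nu>" and len: "length \<nu> \<le> r" and t: "0 < t"
  shows "is_t_core t \<nu> \<longleftrightarrow> (\<forall>b\<in>beta r (part \<nu>). t \<le> b \<longrightarrow> b - t \<in> beta r (part \<nu>))"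
proof -
  have l: "antimono (part \<nu>)" using \<nu> by (rule antimono_part)
  have lr: "part \<nu> r = 0" using len by (simp add: part_def)
  have "(\<exists>\<mu>. is_t_rim_hook t \<nu> \<mu>) \<longleftrightarrow>
      (\<exists>b\<in>beta r (part \<nu>). t \<le> b \<and> b - t \<notin> beta r (part \<nu>))"
  proof
    assume "\<exists>\<mu>. is_t_rim_hook t \<nu> \<mu>"
    then obtain \<mu> where \<mu>: "is_partition \<mu>" "\<And>k. part \<mu> k \<le> part \<nu> k"
      "connected_shape (skew_shape \<nu> \<mu>)" "\<not> contains_2x2_block (skew_shape \<nu> \<mu>)"
      "card (skew_shape \<nu> \<mu>) = t"
      by (auto simp: is_t_rim_hook_def is_rim_hook_def young_diagram_subset_iff)
    have m: "antimono (part \<mu>)" using \<mu>(1) by (rule antimono_part)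
    \<comment> \<open>Positivity of \<open>t\<close> excludes the empty shape, which counts as
      connected, and also infinite sets, whose \<open>card\<close> is 0.\<close>
    have "finite (skew_shape \<nu> \<mu>)" "skew_shape \<nu> \<mu> \<noteq> {}"
      using t \<mu>(5) card_ge_0_finite by auto
    then obtain i j where "ribbon (part \<nu>) (part \<mu>) i j"
      using ex_ribbon[OF l m \<mu>(2) skew_shape_part \<mu>(3,4)] by blast
    thus "\<exists>b\<in>beta r (part \<nu>). t \<le> b \<and> b - t \<notin> beta r (part \<nu>)"
      using ribbon_imp_missing[OF l m lr] \<mu>(5) by (simp add: skew_shape_part)
  next
    assume "\<exists>b\<in>beta r (part \<nu>). t \<le> b \<and> b - t \<notin> beta r (part \<nu>)"
    then obtain b where b: "b \<in> beta r (part \<nu>)" "t \<le> b" "b - t \<notin> beta r (part \<nu>)" by blast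
    obtain m i j where m: "antimono m" "m r = 0" "ribbon (part \<nu>) m i j"
      "card {(k, c). m k \<le> c \<and> c < part \<nu> k} = t"
      using missing_imp_ribbon[OF l lr b(1) t b(2,3)] by blast
    obtain \<mu> where \<mu>: "is_partition \<mu>" "part \<mu> = m"
      using ex_partition_part[OF m(1,2)] by blast
    have "is_t_rim_hook t \<nu> \<mu>"
      unfolding is_t_rim_hook_def is_rim_hook_def young_diagram_subset_iff skew_shape_part \<mu>(2)
      using \<mu>(1) m(4) ribbon_le[OF l m(3)] ribbon_connected[OF l m(3)] ribbon_no_block[OF l m(3)]
      by blast
    thus "\<exists>\<mu>. is_t_rim_hook t \<nu> \<mu>" ..
  qed
  thus ?thesis using \<nu> by (auto simp: is_t_core_def)
qed

section \<open>Beta-sets as arbitrary subsets of size r\<close>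

text \<open>A finite set has only one strictly decreasing enumeration; rows from \<open>r\<close> on
  are zero for both functions.\<close>

lemma beta_inject:
  assumes l: "antimono l" and m: "antimono m" and zero: "l r = 0" "m r = 0"
    and eq: "beta r l = beta r m"
  shows "l = m"
proof
  fix k
  \<comment> \<open>The \<open>k\<close>-th value for \<open>f\<close> is some value for
    \<open>g\<close>; its index \<open>n\<close> cannot be below \<open>k\<close>, where both
    enumerations agree. Exchanging the roles of the functions then yields equality.\<close>
  have aux: "beta_fun r f k = beta_fun r g k \<or> beta_fun r f k < beta_fun r g k"
    if f: "antimono f" and g: "antimono g" and "beta r f = beta r g" "k < r"
      and IH: "\<And>n. n < k \<Longrightarrow> beta_fun r f n = beta_fun r g n" for f g k
  proof -
    have "beta_fun r f k \<in> beta r g" using that by (auto simp: beta_def)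
    then obtain n where n: "n < r" "beta_fun r f k = beta_fun r g n" by (auto simp: beta_def)
    have "\<not> n < k" using beta_fun_less[OF f, of n k r] IH[of n] n \<open>k < r\<close> by auto
    thus ?thesis using beta_fun_less[OF g, of k n r] n by (cases "n = k") auto
  qed
  have "beta_fun r l k = beta_fun r m k" if "k < r" for k
    using that
  proof (induction k rule: less_induct)
    case (less k)
    thus ?case
      using aux[OF l m eq, of k] aux[OF m l eq[symmetric], of k] by fastforce
  qed
  hence below: "l k = m k" if "k < r"
    using that by (metis add_right_cancel beta_fun_def)
  show "l k = m k"
  proof (cases "k < r")
    case False
    hence "l k \<le> l r" "m k \<le> m r" using l m by (simp_all add: antimono_def)
    thus ?thesis using zero by simp
  qed (rule below)
qed

text \<open>List \<open>B\<close> decreasingly and subtract the staircase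
  \<open>r - 1, ..., 0\<close>. Strict descent makes the difference antitone, and the largest
  element, below \<open>r + s\<close>, bounds \<open>l 0\<close> by \<open>s\<close>.\<close>

lemma ex_beta:
  assumes B: "B \<subseteq> {..<r + s}" "card B = r"
  obtains l where "antimono l" "l r = 0" "l 0 \<le> s" "beta r l = B"
proof -
  have fin: "finite B" using B(1) finite_subset by blast
  define xs where "xs = rev (sorted_list_of_set B)"
  have len: "length xs = r" and set: "set xs = B" using fin B by (simp_all add: xs_def)
  have "sorted_wrt (>) xs"
    unfolding xs_def sorted_wrt_rev using strict_sorted_list_of_set by simp
  \<comment> \<open>Every index still leaves room below for the strictly smaller later entries,
    which yields \<open>low\<close>, the bound that makes the staircase subtraction exact.\<close>
  hence dec: "xs ! j < xs ! i" if "i < j" "j < r" for i j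
    using that len by (simp add: sorted_wrt_iff_nth_less)
  have low: "r - Suc i \<le> xs ! i" if "i < r" for i
  proof -
    have "i \<le> r - 1" using that by simp
    thus ?thesis
    proof (induction rule: inc_induct)
      case (step n)
      have "xs ! Suc n < xs ! n" using step by (intro dec) auto
      thus ?case using step by simp
    qed simp
  qed
  define l where "l i = (if i < r then xs ! i - (r - Suc i) else 0)" for i
  have beta_l: "beta_fun r l i = xs ! i" if "i < r" for i
    using low[OF that] that by (simp add: beta_fun_def l_def)
  have "antimono l"
    unfolding antimono_iff_le_Suc
  proof
    fix n
    show "l (Suc n) \<le> l n"
    proof (cases "Suc n < r")
      case True
      thus ?thesis using dec[of n "Suc n"] by (simp add: l_def)
    qed (simp add: l_def)
  qed
  moreover have "l 0 \<le> s"
  proof (cases "0 < r")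
    case True
    hence "xs ! 0 \<in> B" using len set by (metis nth_mem)
    thus ?thesis using B(1) True by (auto simp: l_def)
  qed (simp add: l_def)
  moreover have "beta r l = B"
  proof -
    have "beta r l = (\<lambda>i. xs ! i) ` {..<r}" unfolding beta_def using beta_l by simp
    also have "\<dots> = B" using set len by (auto simp: set_conv_nth)
    finally show ?thesis .
  qed
  ultimately show thesis using that by (simp add: l_def)
qed

text \<open>In abacus terms: \<open>r\<close> beads on positions below \<open>n\<close>, with no
  bead having a gap directly before it on its runner modulo \<open>t\<close>.\<close>

definition flush_sets :: "nat \<Rightarrow> nat \<Rightarrow> nat \<Rightarrow> nat set set" where
  "flush_sets t r n = {B. B \<subseteq> {..<n} \<and> card B = r \<and> (\<forall>b\<in>B. t \<le> b \<longrightarrow> b - t \<in> B)}"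

text \<open>At most \<open>r\<close> parts means that padding to \<open>r\<close> rows is possible,
  and a first part of at most \<open>s\<close> means that all beta-numbers lie below
  \<open>r + s\<close>.\<close>

lemma bij_betw_t_cores_flush_sets:
  assumes "0 < t"
  shows "bij_betw (\<lambda>\<nu>. beta r (part \<nu>)) (t_cores_in_rectangle t r s) (flush_sets t r (r + s))"
  unfolding bij_betw_def
proof (intro conjI subset_antisym subsetI)
  show "inj_on (\<lambda>\<nu>. beta r (part \<nu>)) (t_cores_in_rectangle t r s)"
  proof (rule inj_onI)
    fix \<nu> \<mu> assume "\<nu> \<in> t_cores_in_rectangle t r s" "\<mu> \<in> t_cores_in_rectangle t r s"
      and eq: "beta r (part \<nu>) = beta r (part \<mu>)"
    hence p: "is_partition \<nu>" "is_partition \<mu>" "length \<nu> \<le> r" "length \<mu> \<le> r"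
      by (auto simp: t_cores_in_rectangle_def is_t_core_def)
    have "part \<nu> = part \<mu>"
      using p eq by (intro beta_inject[where r = r] antimono_part) (auto simp: part_def)
    thus "\<nu> = \<mu>" using p by (intro part_inject)
  qed
next
  fix B assume "B \<in> (\<lambda>\<nu>. beta r (part \<nu>)) ` t_cores_in_rectangle t r s"
  then obtain \<nu> where B: "B = beta r (part \<nu>)" and core: "is_t_core t \<nu>"
    and len: "length \<nu> \<le> r" and s: "part \<nu> 0 \<le> s"
    by (auto simp: t_cores_in_rectangle_def first_part_part)
  have p: "is_partition \<nu>" using core by (simp add: is_t_core_def)
  note anti = antimono_part[OF p]
  have "beta_fun r (part \<nu>) i < r + s" if "i < r" for i
    using antimonoD[OF anti, of 0 i] that s by (simp add: beta_fun_def)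
  hence "B \<subseteq> {..<r + s}" by (auto simp: B beta_def)
  moreover have "card B = r"
    unfolding B beta_def using inj_on_beta_fun[OF anti] by (simp add: card_image)
  ultimately show "B \<in> flush_sets t r (r + s)"
    using core is_t_core_iff_beta[OF p len assms] B by (simp add: flush_sets_def)
next
  fix B assume "B \<in> flush_sets t r (r + s)"
  hence B: "B \<subseteq> {..<r + s}" "card B = r" "\<forall>b\<in>B. t \<le> b \<longrightarrow> b - t \<in> B"
    by (auto simp: flush_sets_def)
  obtain l where l: "antimono l" "l r = 0" "l 0 \<le> s" "beta r l = B"
    using ex_beta[OF B(1,2)] by blast
  obtain \<nu> where \<nu>: "is_partition \<nu>" "part \<nu> = l" "length \<nu> \<le> r"
    using ex_partition_part[OF l(1,2)] by blast
  have "is_t_core t \<nu>" using is_t_core_iff_beta[OF \<nu>(1,3) assms] B(3) \<nu>(2) l(4) by simp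
  hence "\<nu> \<in> t_cores_in_rectangle t r s"
    using \<nu> l by (simp add: t_cores_in_rectangle_def first_part_part)
  thus "B \<in> (\<lambda>\<nu>. beta r (part \<nu>)) ` t_cores_in_rectangle t r s"
    using \<nu>(2) l(4) by (intro image_eqI[of _ _ \<nu>]) auto
qed

section \<open>Residue classes\<close>

text \<open>The abacus whose runner \<open>i\<close> carries its beads in the first
  \<open>c i\<close> positions \<open>i, i + t, ...\<close>.\<close>

definition runner_set :: "nat \<Rightarrow> (nat \<Rightarrow> nat) \<Rightarrow> nat set" where
  "runner_set t c = {b. b div t < c (b mod t)}"

lemma mem_runner_set:
  "i < t \<Longrightarrow> t * q + i \<in> runner_set t c \<longleftrightarrow> q < c i"
  by (simp add: runner_set_def)

lemma card_runner_set:
  assumes "0 < t"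
  shows "card (runner_set t c) = (\<Sum>i<t. c i)"
proof -
  have "bij_betw (\<lambda>b. (b mod t, b div t)) (runner_set t c) (SIGMA i:{..<t}. {..<c i})"
    by (rule bij_betw_byWitness[where f' = "\<lambda>(i, q). t * q + i"])
      (use assms in \<open>auto simp: runner_set_def\<close>)
  hence "card (runner_set t c) = card (SIGMA i:{..<t}. {..<c i})"
    by (rule bij_betw_same_card)
  thus ?thesis by simp
qed

text \<open>The quotient is the number of elements of residue \<open>i\<close> below
  \<open>n\<close>, so it exceeds \<open>q\<close> exactly when the element with quotient
  \<open>q\<close> is still below \<open>n\<close>.\<close>

lemma residue_class_bound:
  fixes t :: nat
  assumes "i < t"
  shows "Suc q \<le> (n + t - 1 - i) div t \<longleftrightarrow> t * q + i < n"
  using assms by (auto simp: less_eq_div_iff_mult_less_eq algebra_simps)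

text \<open>Subtracting \<open>t\<close> keeps the residue and lowers the quotient by one, so
  closure makes each residue class of \<open>B\<close> an initial segment, determined by its
  length.\<close>

lemma bij_betw_runner_set:
  assumes "0 < t"
  shows "bij_betw (runner_set t)
    {c \<in> (\<Pi>\<^sub>E i\<in>{..<t}. {0..(n + t - 1 - i) div t}). (\<Sum>i<t. c i) = r} (flush_sets t r n)"
    (is "bij_betw _ ?C _")
  unfolding bij_betw_def
proof (intro conjI subset_antisym subsetI)
  show "inj_on (runner_set t) ?C"
  proof (rule inj_onI)
    fix c d assume c: "c \<in> ?C" and d: "d \<in> ?C" and eq: "runner_set t c = runner_set t d"
    \<comment> \<open>Membership of the elements with quotients \<open>c i\<close> and
      \<open>d i\<close> rules out that either count is smaller.\<close>
    have "c i = d i" if "i < t" for i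
      using mem_runner_set[OF that, of "c i" d] mem_runner_set[OF that, of "c i" c]
        mem_runner_set[OF that, of "d i" d] mem_runner_set[OF that, of "d i" c] eq by auto
    thus "c = d" using c d by (intro PiE_ext[of c _ _ d]) auto
  qed
next
  fix B assume "B \<in> runner_set t ` ?C"
  then obtain c where c: "c \<in> ?C" and B: "B = runner_set t c" by blast
  have "b < n" if "b \<in> B" for b
  proof -
    have "Suc (b div t) \<le> c (b mod t)" using that by (simp add: B runner_set_def)
    also have "\<dots> \<le> (n + t - 1 - b mod t) div t" using c assms by (auto simp: PiE_iff)
    finally show ?thesis using residue_class_bound[of "b mod t" t "b div t" n] assms by simp
  qed
  moreover have "b - t \<in> B" if "b \<in> B" "t \<le> b" for b
    using that assms by (simp add: B runner_set_def le_div_geq le_mod_geq)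
  moreover have "card B = r" using c card_runner_set[OF assms] B by auto
  ultimately show "B \<in> flush_sets t r n" by (auto simp: flush_sets_def)
next
  fix B assume "B \<in> flush_sets t r n"
  hence B: "B \<subseteq> {..<n}" "card B = r" and flush: "\<And>b. b \<in> B \<Longrightarrow> t \<le> b \<Longrightarrow> b - t \<in> B"
    by (auto simp: flush_sets_def)
  have "\<exists>k. \<forall>q. t * q + i \<in> B \<longleftrightarrow> q < k" for i
  proof
    \<comment> \<open>The first gap on the runner; one exists since \<open>t * n + i\<close> is at
      least \<open>n\<close>. By closure no bead can follow a gap.\<close>
    define k where "k = (LEAST q. t * q + i \<notin> B)"
    have "t * n + i \<notin> B"
    proof
      assume "t * n + i \<in> B"
      hence "t * n + i < n" using B(1) by auto
      moreover have "n \<le> t * n" using assms by simp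
      ultimately show False by simp
    qed
    hence k: "t * k + i \<notin> B" unfolding k_def by (rule LeastI)
    have "t * (k + d) + i \<notin> B" for d
    proof (induction d)
      case (Suc d)
      thus ?case using flush[of "t * (k + Suc d) + i"] by (auto simp: algebra_simps)
    qed (use k in simp)
    hence "t * q + i \<notin> B" if "k \<le> q" for q using that by (metis le_add_diff_inverse)
    moreover have "t * q + i \<in> B" if "q < k" for q
      using not_less_Least[of q "\<lambda>q. t * q + i \<notin> B"] that by (simp add: k_def)
    ultimately show "\<forall>q. t * q + i \<in> B \<longleftrightarrow> q < k"
      by (meson not_less)
  qed
  then obtain k where k: "\<And>i q. t * q + i \<in> B \<longleftrightarrow> q < k i" by metis
  \<comment> \<open>Extensional functions are undefined off \<open>{..<t}\<close>, which makes the
    preimage unique.\<close>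
  define c where "c = restrict k {..<t}"
  have Bc: "B = runner_set t c"
  proof (rule set_eqI)
    fix b
    have "b \<in> B \<longleftrightarrow> b div t < k (b mod t)" using k[of "b div t" "b mod t"] by simp
    thus "b \<in> B \<longleftrightarrow> b \<in> runner_set t c" using assms by (simp add: runner_set_def c_def)
  qed
  have "k i \<le> (n + t - 1 - i) div t" if "i < t" for i
  proof (cases "k i")
    case (Suc q)
    hence "t * q + i \<in> B" by (simp add: k)
    thus ?thesis using B(1) residue_class_bound[OF that] Suc by auto
  qed simp
  hence "c \<in> ?C" using B(2) card_runner_set[OF assms, of c] Bc by (auto simp: c_def)
  thus "B \<in> runner_set t ` ?C" using Bc by blast
qed

section \<open>Coefficients as counts of exponent choices\<close>

text \<open>Expanding the product chooses one exponent \<open>c i\<close> from each factor, and the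
  choice contributes a monomial whose degree is the sum of these exponents.\<close>

lemma coeff_prod_sum_monom:
  fixes A :: "'a \<Rightarrow> nat set"
  assumes "finite I" "\<And>i. i \<in> I \<Longrightarrow> finite (A i)"
  shows "coeff (\<Prod>i\<in>I. \<Sum>k\<in>A i. monom (1 :: 'b :: comm_semiring_1) k) r =
    of_nat (card {c \<in> (\<Pi>\<^sub>E i\<in>I. A i). (\<Sum>i\<in>I. c i) = r})"
proof -
  have monom: "(\<Prod>i\<in>I. monom (1 :: 'b) (c i)) = monom 1 (\<Sum>i\<in>I. c i)" for c :: "'a \<Rightarrow> nat"
    using assms(1) by (induction I rule: finite_induct) (auto simp: mult_monom)
  have fin: "finite (\<Pi>\<^sub>E i\<in>I. A i)" using assms by (intro finite_PiE)
  have "(\<Prod>i\<in>I. \<Sum>k\<in>A i. monom (1 :: 'b) k) = (\<Sum>c\<in>(\<Pi>\<^sub>E i\<in>I. A i). monom 1 (\<Sum>i\<in>I. c i))"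
    using assms by (simp add: prod_sum_PiE monom)
  thus ?thesis
    using fin by (simp add: coeff_sum sum.If_cases Int_def)
qed

theorem proposition3p5:
  fixes r s t :: nat
  assumes "r \<ge> 1" and "s \<ge> 1" and "t \<ge> 2"
  shows "int (num_t_cores t r s) =
    coeff (\<Prod>i=0..t - 1. \<Sum>k=0..(r + s + t - 1 - i) div t. monom (1::int) k) r"
proof -
  have t: "0 < t" using assms by simp
  have "num_t_cores t r s = card (flush_sets t r (r + s))"
    unfolding num_t_cores_def by (rule bij_betw_same_card[OF bij_betw_t_cores_flush_sets[OF t]])
  also have "\<dots> = card {c \<in> (\<Pi>\<^sub>E i\<in>{..<t}. {0..(r + s + t - 1 - i) div t}). (\<Sum>i<t. c i) = r}"
    by (rule bij_betw_same_card[OF bij_betw_runner_set[OF t], symmetric])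
  moreover have "{0..t - 1} = {..<t}" using t by auto
  ultimately show ?thesis by (simp add: coeff_prod_sum_monom)
qed

end
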